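(* Let $u(x)=e^{|x|}$, $x\in\mathbb R$, and $w=\chi_{(0,1)}$. Then $M:\Lambda^q_u(w)\to\Lambda^q_u(w)$ is bounded for every $q>1$. Therefore it is not necessary, in general, that the weight $u$ be doubling in order to have the boundedness $M:\Lambda^p_u(w)\to\Lambda^p_u(w)$ (the weight $u(x)=e^{|x|}$ is not doubling).
   Context: $M$ is the Hardy–Littlewood maximal operator on $\mathbb R$: $Mf(x)=\sup_{x\in Q}\frac1{|Q|}\int_Q|f(y)|\,dy$, the supremum over bounded intervals $Q\ni x$. For a weight $u$ on $\mathbb R$, $u(A)=\int_Au(x)\,dx$, $\lambda^u_f(t)=u(\{|f|>t\})$, $f^*_u(t)=\inf\{s>0:\lambda^u_f(s)\le t\}$, and for a weight $w$ on $(0,\infty)$ and $0<q<\infty$, $\|f\|_{\Lambda^q_u(w)}=\big(\int_0^\infty (f^*_u(t))^qw(t)\,dt\big)^{1/q}$. Boundedness of $M$ on $\Lambda^q_u(w)$ means $\|Mf\|_{\Lambda^q_u(w)}\le C\|f\|_{\Lambda^q_u(w)}$ for all $f$ with finite right-hand side, $C$ independent of $f$. The weight $u$ is doubling if there is $C$ with $u(2Q)\le Cu(Q)$ for every interval $Q$, where $2Q$ has the same center as $Q$ and twice its length. *)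

theory Defs
  imports "HOL-Analysis.Analysis"
begin

text \<open>
  Measurability is Lebesgue measurability throughout. Weights are real-valued functions that are
  nonnegative on their domain. A function enters the definitions below only through its modulus, so
  these take functions with values in \<^typ>\<open>ennreal\<close>: a maximal function may take the value
  infinity, and a complex function \<open>f\<close> is used as \<open>\<lambda>x. ennreal (cmod (f x))\<close>.
\<close>

definition intervals :: "real set set" where
  "intervals = {Q. is_interval Q \<and> bounded Q \<and> emeasure lebesgue Q > 0}"

definition maximal :: "(real \<Rightarrow> ennreal) \<Rightarrow> real \<Rightarrow> ennreal" where
  "maximal g x =
     (SUP Q \<in> {Q \<in> intervals. x \<in> Q}. (\<integral>\<^sup>+y\<in>Q. g y \<partial>lebesgue) / emeasure lebesgue Q)"

text \<open>
  Intersecting the domain with \<^term>\<open>{a..b}\<close> makes a weight on \<open>(0,\<infinity>)\<close> integrable up to the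
  endpoint 0, that is \<open>\<integral>\<^sub>0\<^sup>r w < \<infinity>\<close> for all \<open>r\<close>. The last conjunct
  excludes the trivial weight.
\<close>

definition weight_on :: "real set \<Rightarrow> (real \<Rightarrow> real) \<Rightarrow> bool" where
  "weight_on S v \<longleftrightarrow>
     (\<forall>x\<in>S. 0 \<le> v x) \<and>
     (\<forall>a b. set_integrable lebesgue (S \<inter> {a..b}) v) \<and>
     \<not> (AE x in lebesgue. x \<in> S \<longrightarrow> v x = 0)"

definition wmeas :: "(real \<Rightarrow> real) \<Rightarrow> real set \<Rightarrow> ennreal" where
  "wmeas u A = (\<integral>\<^sup>+x\<in>A. ennreal (u x) \<partial>lebesgue)"

definition distr_fun :: "(real \<Rightarrow> real) \<Rightarrow> (real \<Rightarrow> ennreal) \<Rightarrow> real \<Rightarrow> ennreal" where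
  "distr_fun u g t = wmeas u {x. g x > ennreal t}"

text \<open>The infimum of the empty set is infinity here.\<close>

definition rearrangement :: "(real \<Rightarrow> real) \<Rightarrow> (real \<Rightarrow> ennreal) \<Rightarrow> real \<Rightarrow> ennreal" where
  "rearrangement u g t = (INF s \<in> {s. 0 < s \<and> distr_fun u g s \<le> ennreal t}. ennreal s)"

text \<open>Real powers on \<open>[0,\<infinity>]\<close>, for positive exponents only.\<close>

definition epowr :: "ennreal \<Rightarrow> real \<Rightarrow> ennreal" where
  "epowr x q = (if x = \<infinity> then \<infinity> else ennreal (enn2real x powr q))"

definition lorentz_norm ::
    "real \<Rightarrow> (real \<Rightarrow> real) \<Rightarrow> (real \<Rightarrow> real) \<Rightarrow> (real \<Rightarrow> ennreal) \<Rightarrow> ennreal" where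
  "lorentz_norm q u w g =
     epowr (\<integral>\<^sup>+t\<in>{0<..}. epowr (rearrangement u g t) q * ennreal (w t) \<partial>lebesgue) (1 / q)"

definition maximal_bounded_on_lorentz ::
    "real \<Rightarrow> (real \<Rightarrow> real) \<Rightarrow> (real \<Rightarrow> real) \<Rightarrow> bool" where
  "maximal_bounded_on_lorentz q u w \<longleftrightarrow>
     (\<exists>C::real. \<forall>f :: real \<Rightarrow> complex.
        f \<in> borel_measurable lebesgue \<longrightarrow>
        lorentz_norm q u w (\<lambda>x. ennreal (cmod (f x))) < \<infinity> \<longrightarrow>
        lorentz_norm q u w (maximal (\<lambda>x. ennreal (cmod (f x))))
          \<le> ennreal C * lorentz_norm q u w (\<lambda>x. ennreal (cmod (f x))))"

definition double_interval :: "real set \<Rightarrow> real set" where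
  "double_interval Q = (let c = (Inf Q + Sup Q) / 2 in (\<lambda>x. c + 2 * (x - c)) ` Q)"

definition doubling :: "(real \<Rightarrow> real) \<Rightarrow> bool" where
  "doubling u \<longleftrightarrow>
     (\<exists>C::real. \<forall>Q\<in>intervals. wmeas u (double_interval Q) \<le> ennreal C * wmeas u Q)"

end

theory Submission
  imports Defs
begin

text \<open>
  Let \<open>u x = exp \<bar>x\<bar>\<close> and \<open>A > \<parallel>f\<parallel>\<close>. Then \<open>u {\<bar>f\<bar> \<ge> A} \<le> 1\<close>, and the norm, which only sees the
  rearrangement on \<open>(0,1)\<close>, controls \<open>\<integral> \<bar>f\<bar>\<^sup>q u\<close> over \<open>{\<bar>f\<bar> \<ge> A}\<close> by \<open>A\<^sup>q\<close>. Since \<open>u \<ge> 1\<close>,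
  intervals longer than 1 give averages of the part of \<open>f\<close> above \<open>A\<close> that are at most \<open>A\<close>, so at
  levels above \<open>2 A\<close> only intervals of length at most 1 matter. On these \<open>u\<close> is constant up to a
  bounded factor, hence Vitali's covering lemma yields a weak type (1,1) estimate with weight \<open>u\<close>.
  Marcinkiewicz' truncation argument turns it into the strong type \<open>q\<close> estimate.
\<close>

section \<open>Real powers on \<open>[0,\<infinity>]\<close> and the layer-cake formula\<close>

text \<open>Supplies the sigma-finiteness that Tonelli's theorem asks for below. A countable cover
  that works for \<open>lborel\<close> still works, since completion keeps the measure of Borel
  sets.\<close>

lemma sigma_finite_lebesgue: "sigma_finite_measure (lebesgue :: 'a::euclidean_space measure)"
proof
  obtain A :: "'a set set" where A: "countable A" "A \<subseteq> sets lborel" "\<Union>A = space lborel"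
    "\<forall>a\<in>A. emeasure lborel a \<noteq> \<infinity>"
    using lborel.sigma_finite_countable by blast
  have "emeasure lebesgue a \<noteq> \<infinity>" if "a \<in> A" for a
    using A that by (subst emeasure_completion) (auto simp: subset_iff)
  with A show "\<exists>A. countable A \<and> A \<subseteq> sets lebesgue \<and> \<Union>A = space lebesgue \<and>
      (\<forall>a\<in>A. emeasure (lebesgue :: 'a measure) a \<noteq> (\<infinity>::ennreal))"
    by (intro exI[of _ A]) auto
qed

lemma epowr_ennreal: "0 \<le> y \<Longrightarrow> epowr (ennreal y) q = ennreal (y powr q)"
  by (simp add: epowr_def)

lemma epowr_mono: "x \<le> y \<Longrightarrow> 0 < q \<Longrightarrow> epowr x q \<le> epowr y q"
  by (cases x; cases y) (auto simp: epowr_def powr_mono2 top_unique)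

text \<open>Integration of the derivative of \<open>s powr q\<close>. The range of \<open>s\<close>
  is phrased through \<open>ennreal s\<close> so that an infinite \<open>y\<close> gives the whole
  half-line.\<close>

lemma epowr_eq_nn_integral:
  assumes q: "0 < q"
  shows "epowr y q = (\<integral>\<^sup>+s. ennreal (q * s powr (q - 1)) * indicator {s. 0 \<le> s \<and> ennreal s \<le> y} s \<partial>lborel)"
    (is "_ = ?I y")
proof -
  have *: "?I (ennreal c) = ennreal (c powr q)" if "0 \<le> c" for c
  proof -
    have "((\<lambda>s. s powr (q - 1)) has_integral (c powr (q - 1 + 1) / (q - 1 + 1))) {0..c}"
      using that q by (intro has_integral_powr_from_0) auto
    then have "((\<lambda>s. q * s powr (q - 1)) has_integral (q * (c powr (q - 1 + 1) / (q - 1 + 1)))) {0..c}"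
      by (rule has_integral_mult_right)
    then have "((\<lambda>s. q * s powr (q - 1)) has_integral (c powr q)) {0..c}"
      using q by simp
    then have "(\<integral>\<^sup>+s. ennreal (q * s powr (q - 1)) * indicator {0..c} s \<partial>lborel) = ennreal (c powr q)"
      using q by (intro nn_integral_has_integral_lebesgue') auto
    moreover have "{s. 0 \<le> s \<and> ennreal s \<le> ennreal c} = {0..c}"
      using that by auto
    ultimately show ?thesis by simp
  qed
  show ?thesis
  proof (cases y)
    case (real r)
    then show ?thesis using * by (simp add: epowr_ennreal)
  next
    case top
    \<comment> \<open>The integral over the half-line dominates the one up to
      \<open>r powr (1 / q)\<close>, whose value is \<open>r\<close>. As \<open>r\<close> is
      arbitrary, it is infinite.\<close>
    have le: "ennreal r \<le> ?I \<infinity>" if "0 \<le> r" for r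
    proof -
      have "ennreal r = ?I (ennreal (r powr (1 / q)))"
        using that q by (subst *) (auto simp: powr_powr)
      also have "\<dots> \<le> ?I \<infinity>"
        by (intro nn_integral_mono mult_left_mono) (auto split: split_indicator)
      finally show ?thesis .
    qed
    have "?I \<infinity> = \<infinity>"
    proof (cases "?I \<infinity>" rule: ennreal_cases)
      case (real b)
      with le[of "b + 1"] show ?thesis by simp
    qed simp
    with top show ?thesis by (simp add: epowr_def)
  qed
qed

text \<open>Tonelli applied to \<open>epowr_eq_nn_integral\<close>. The kernel \<open>k\<close> will
  be the indicator of \<open>(0,1)\<close>, a truncated weight, or \<open>g\<close> times that
  weight.\<close>

lemma layer_cake:
  assumes M: "sigma_finite_measure M"
    and h[measurable]: "h \<in> borel_measurable M" and k[measurable]: "k \<in> borel_measurable M"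
    and q: "0 < q"
  shows "(\<integral>\<^sup>+x. epowr (h x) q * k x \<partial>M) =
    (\<integral>\<^sup>+s. ennreal (q * s powr (q - 1)) * indicator {0..} s *
      (\<integral>\<^sup>+x. k x * indicator {x. ennreal s \<le> h x} x \<partial>M) \<partial>lborel)"
proof -
  interpret sigma_finite_measure M by fact
  interpret pair_sigma_finite M "lborel :: real measure" ..
  define H where "H x s = ennreal (q * s powr (q - 1)) * indicator {0..} s *
      (k x * indicator {p. ennreal (snd p) \<le> h (fst p)} (x, s))" for x s
  have [measurable]: "{p \<in> space (M \<Otimes>\<^sub>M lborel). ennreal (snd p) \<le> h (fst p)} \<in> sets (M \<Otimes>\<^sub>M lborel)"
    by measurable
  have meas: "case_prod H \<in> borel_measurable (M \<Otimes>\<^sub>M lborel)"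
  proof -
    have "(\<lambda>p. ennreal (q * snd p powr (q - 1)) * indicator {0..} (snd p) *
      (k (fst p) * indicator {p \<in> space (M \<Otimes>\<^sub>M lborel). ennreal (snd p) \<le> h (fst p)} p)) \<in> borel_measurable (M \<Otimes>\<^sub>M lborel)"
      by measurable
    then show ?thesis
      by (rule measurable_cong[THEN iffD1, rotated])
        (auto simp: H_def space_pair_measure split: split_indicator)
  qed
  have "(\<integral>\<^sup>+x. epowr (h x) q * k x \<partial>M) = (\<integral>\<^sup>+x. (\<integral>\<^sup>+s. H x s \<partial>lborel) \<partial>M)"
  proof (rule nn_integral_cong)
    fix x assume "x \<in> space M"
    have "(\<integral>\<^sup>+s. H x s \<partial>lborel) = (\<integral>\<^sup>+s. ennreal (q * s powr (q - 1)) *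
        indicator {s. 0 \<le> s \<and> ennreal s \<le> h x} s * k x \<partial>lborel)"
      by (intro nn_integral_cong) (auto simp: H_def split: split_indicator)
    also have "\<dots> = epowr (h x) q * k x"
      unfolding epowr_eq_nn_integral[OF q]
      by (rule nn_integral_multc) measurable
    finally show "epowr (h x) q * k x = (\<integral>\<^sup>+s. H x s \<partial>lborel)" ..
  qed
  also have "\<dots> = (\<integral>\<^sup>+s. (\<integral>\<^sup>+x. H x s \<partial>M) \<partial>lborel)"
    by (rule Fubini'[OF meas, symmetric])
  also have "\<dots> = (\<integral>\<^sup>+s. ennreal (q * s powr (q - 1)) * indicator {0..} s *
      (\<integral>\<^sup>+x. k x * indicator {x. ennreal s \<le> h x} x \<partial>M) \<partial>lborel)"
    by (intro nn_integral_cong, unfold H_def, subst nn_integral_cmult)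
      (auto simp: indicator_def of_bool_def)
  finally show ?thesis .
qed

section \<open>Weak type (1,1) estimate for short intervals\<close>

text \<open>
  For radii at most \<open>1/2\<close> the weight on \<open>cball a (5 * r)\<close> is at most \<open>e\<^sup>3\<close> times the weight on
  \<open>cball a r\<close>. This gives the constant \<open>5 e\<^sup>3\<close> and replaces the doubling property.
  The set \<open>S\<close> need not be measurable.
\<close>

lemma weak_type_exp_abs:
  fixes S :: "real set" and h :: "real \<Rightarrow> ennreal"
  assumes h[measurable]: "h \<in> borel_measurable lebesgue"
    and S: "\<And>x. x \<in> S \<Longrightarrow> \<exists>a r. x \<in> cball a r \<and> 0 < r \<and> r \<le> 1/2 \<and>
      ennreal (s * (2 * r)) \<le> (\<integral>\<^sup>+y\<in>cball a r. h y \<partial>lebesgue)"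
    and s: "0 < s"
  shows "ennreal s * wmeas (\<lambda>x. exp \<bar>x\<bar>) S
    \<le> ennreal (5 * exp 3) * (\<integral>\<^sup>+y. h y * ennreal (exp \<bar>y\<bar>) \<partial>lebesgue)"
proof -
  \<comment> \<open>Balls as pairs of centre and radius, the indexing used by Vitali's lemma; the
    bound \<open>1/2\<close> on the radii is the uniform bound that it requires.\<close>
  define K :: "(real \<times> real) set" where "K = {(a, r). 0 < r \<and> r \<le> 1/2 \<and>
      ennreal (s * (2 * r)) \<le> (\<integral>\<^sup>+y\<in>cball a r. h y \<partial>lebesgue)}"
  have "S \<subseteq> (\<Union>i\<in>K. cball (fst i) (snd i))"
    using S by (force simp: K_def)
  moreover have "0 < snd i \<and> snd i \<le> 1/2" if "i \<in> K" for i
    using that by (auto simp: K_def)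
  ultimately obtain C where C: "countable C" "C \<subseteq> K"
     "pairwise (\<lambda>i j. disjnt (cball (fst i) (snd i)) (cball (fst j) (snd j))) C"
     "S \<subseteq> (\<Union>i\<in>C. cball (fst i) (5 * snd i))"
    by (rule Vitali_covering_lemma_cballs)
  let ?u = "\<lambda>x::real. ennreal (exp \<bar>x\<bar>)"
  have [measurable]: "?u \<in> borel_measurable lebesgue"
    by (intro measurable_completion) measurable
  have [measurable]: "cball a r \<in> sets lebesgue" for a r :: real
    by simp
  have ball: "ennreal s * (\<integral>\<^sup>+x. ?u x * indicator (cball a (5 * r)) x \<partial>lebesgue) \<le>
      ennreal (5 * exp 3) * (\<integral>\<^sup>+x. h x * ?u x * indicator (cball a r) x \<partial>lebesgue)"
    if "(a, r) \<in> K" for a r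
  proof -
    have r: "0 < r" "r \<le> 1/2" and hr: "ennreal (s * (2 * r)) \<le> (\<integral>\<^sup>+y\<in>cball a r. h y \<partial>lebesgue)"
      using that by (auto simp: K_def)
    \<comment> \<open>Since \<open>r \<le> 1/2\<close>, the weight is at most
      \<open>exp (\<bar>a\<bar> + 5/2)\<close> on the dilated ball and at least
      \<open>exp (\<bar>a\<bar> - 1/2)\<close> on the ball itself. The quotient is
      \<open>exp 3\<close>; the lengths \<open>10 * r\<close> and \<open>2 * r\<close> contribute
      the factor 5.\<close>
    have "(\<integral>\<^sup>+x. ?u x * indicator (cball a (5 * r)) x \<partial>lebesgue) \<le>
       (\<integral>\<^sup>+x. ennreal (exp (\<bar>a\<bar> + 5/2)) * indicator (cball a (5 * r)) x \<partial>lebesgue)"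
      using r by (intro nn_integral_mono) (auto simp: dist_real_def split: split_indicator intro!: ennreal_leI)
    also have "\<dots> = ennreal (exp (\<bar>a\<bar> + 5/2)) * emeasure lebesgue (cball a (5 * r))"
      by (subst nn_integral_cmult_indicator) auto
    also have "emeasure lebesgue (cball a (5 * r)) = ennreal (10 * r)"
      using r by (simp add: cball_eq_atLeastAtMost)
    finally have 1: "(\<integral>\<^sup>+x. ?u x * indicator (cball a (5 * r)) x \<partial>lebesgue) \<le> ennreal (exp (\<bar>a\<bar> + 5/2) * (10 * r))"
      using r by (simp add: ennreal_mult)
    have "ennreal (exp (\<bar>a\<bar> - 1/2)) * ennreal (s * (2 * r)) \<le>
        ennreal (exp (\<bar>a\<bar> - 1/2)) * (\<integral>\<^sup>+y\<in>cball a r. h y \<partial>lebesgue)"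
      by (intro mult_left_mono hr) auto
    also have "\<dots> = (\<integral>\<^sup>+y. ennreal (exp (\<bar>a\<bar> - 1/2)) * (h y * indicator (cball a r) y) \<partial>lebesgue)"
      by (rule nn_integral_cmult[symmetric]) measurable
    also have "\<dots> \<le> (\<integral>\<^sup>+x. h x * ?u x * indicator (cball a r) x \<partial>lebesgue)"
      using r by (intro nn_integral_mono)
        (auto simp: dist_real_def mult.commute split: split_indicator intro!: mult_left_mono ennreal_leI)
    finally have 2: "ennreal (exp (\<bar>a\<bar> - 1/2) * (s * (2 * r))) \<le> (\<integral>\<^sup>+x. h x * ?u x * indicator (cball a r) x \<partial>lebesgue)"
      using r s by (simp add: ennreal_mult)
    have "exp (\<bar>a\<bar> + 5/2) = exp 3 * exp (\<bar>a\<bar> - 1/2)"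
      by (simp flip: exp_add)
    then have 3: "s * (exp (\<bar>a\<bar> + 5/2) * (10 * r)) = 5 * exp 3 * (exp (\<bar>a\<bar> - 1/2) * (s * (2 * r)))"
      by simp
    have "ennreal s * (\<integral>\<^sup>+x. ?u x * indicator (cball a (5 * r)) x \<partial>lebesgue) \<le> ennreal s * ennreal (exp (\<bar>a\<bar> + 5/2) * (10 * r))"
      by (intro mult_left_mono 1) auto
    also have "\<dots> = ennreal (5 * exp 3) * ennreal (exp (\<bar>a\<bar> - 1/2) * (s * (2 * r)))"
      using r s 3 by (simp flip: ennreal_mult)
    also have "\<dots> \<le> ennreal (5 * exp 3) * (\<integral>\<^sup>+x. h x * ?u x * indicator (cball a r) x \<partial>lebesgue)"
      by (intro mult_left_mono 2) auto
    finally show ?thesis .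
  qed
  \<comment> \<open>The dilated balls cover \<open>S\<close>, so the sum of their indicators, an
    integral over \<open>count_space C\<close>, dominates that of \<open>S\<close>. Only
    monotonicity of the integral is applied to \<open>S\<close>.\<close>
  have "ennreal s * wmeas (\<lambda>x. exp \<bar>x\<bar>) S \<le>
      ennreal s * (\<integral>\<^sup>+x. (\<integral>\<^sup>+i. ?u x * indicator (cball (fst i) (5 * snd i)) x \<partial>count_space C) \<partial>lebesgue)"
    unfolding wmeas_def
  proof (intro mult_left_mono nn_integral_mono)
    fix x
    show "?u x * indicator S x \<le> (\<integral>\<^sup>+i. ?u x * indicator (cball (fst i) (5 * snd i)) x \<partial>count_space C)"
    proof (cases "x \<in> S")
      case True
      then obtain i where i: "i \<in> C" "x \<in> cball (fst i) (5 * snd i)"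
        using C by auto
      then have "?u x * indicator S x \<le> ?u x * indicator (cball (fst i) (5 * snd i)) x"
        by (auto split: split_indicator)
      also have "\<dots> \<le> (\<integral>\<^sup>+i. ?u x * indicator (cball (fst i) (5 * snd i)) x \<partial>count_space C)"
        using i by (intro nn_integral_ge_point)
      finally show ?thesis .
    qed auto
  qed auto
  also have "\<dots> = (\<integral>\<^sup>+i. ennreal s * (\<integral>\<^sup>+x. ?u x * indicator (cball (fst i) (5 * snd i)) x \<partial>lebesgue) \<partial>count_space C)"
  proof -
    have m: "(\<lambda>x. ?u x * indicator (cball (fst i) (5 * snd i)) x) \<in> borel_measurable lebesgue" for i :: "real \<times> real"
      by measurable
    show ?thesis
      unfolding nn_integral_count_space_nn_integral[OF C(1) m]
      by (rule nn_integral_cmult[symmetric]) simp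
  qed
  also have "\<dots> \<le> (\<integral>\<^sup>+i. ennreal (5 * exp 3) * (\<integral>\<^sup>+x. h x * ?u x * indicator (cball (fst i) (snd i)) x \<partial>lebesgue) \<partial>count_space C)"
    using ball C(2) by (intro nn_integral_mono) auto
  also have "\<dots> = ennreal (5 * exp 3) * (\<integral>\<^sup>+i. emeasure (density lebesgue (\<lambda>x. h x * ?u x)) (cball (fst i) (snd i)) \<partial>count_space C)"
    by (subst nn_integral_cmult) (auto simp: emeasure_density)
  \<comment> \<open>The undilated balls are disjoint, so their masses under the density
    \<open>h\<close> times the weight add up to the mass of the union.\<close>
  also have "(\<integral>\<^sup>+i. emeasure (density lebesgue (\<lambda>x. h x * ?u x)) (cball (fst i) (snd i)) \<partial>count_space C) =
     emeasure (density lebesgue (\<lambda>x. h x * ?u x)) (\<Union>i\<in>C. cball (fst i) (snd i))"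
    using C(1,3) by (intro emeasure_UN_countable[symmetric])
      (auto simp: disjoint_family_on_def pairwise_def disjnt_def)
  also have "\<dots> \<le> emeasure (density lebesgue (\<lambda>x. h x * ?u x)) UNIV"
    by (intro emeasure_mono) auto
  also have "\<dots> = (\<integral>\<^sup>+y. h y * ?u y \<partial>lebesgue)"
    by (subst emeasure_density) auto
  finally show ?thesis
    by (simp add: mult_left_mono)
qed

section \<open>The distribution function of the maximal function at high levels\<close>

text \<open>The closure of a bounded interval is some \<open>{a..b}\<close> and its frontier is
  null, so nothing is lost in measure. This passes from the arbitrary intervals in
  \<open>maximal\<close> to the closed balls of Vitali's lemma.\<close>

lemma intervals_cball:
  assumes "Q \<in> intervals"
  obtains a r where "0 < r" "Q \<subseteq> cball a r" "emeasure lebesgue Q = ennreal (2 * r)" "Q \<in> sets lebesgue"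
proof -
  have Q: "is_interval Q" "bounded Q" "emeasure lebesgue Q > 0"
    using assms by (auto simp: intervals_def)
  have Qm: "Q \<in> sets lebesgue"
    using real_interval_borel_measurable[OF Q(1)] by simp
  have "connected (closure Q)" "compact (closure Q)"
    using Q by (auto simp: is_interval_connected_1 connected_imp_connected_closure)
  then obtain a b where ab: "closure Q = {a..b}"
    using connected_compact_interval_1 by (metis box_real(2))
  have "frontier Q \<in> null_sets lebesgue"
    using negligible_convex_frontier[of Q] Q(1)
    by (simp add: is_interval_convex_1 negligible_iff_null_sets)
  then have "emeasure lebesgue (Q \<union> frontier Q) = emeasure lebesgue Q"
    using Qm by (intro emeasure_Un_null_set)
  moreover have "Q \<union> frontier Q = {a..b}"
    using ab closure_Un_frontier by blast
  ultimately have e: "emeasure lebesgue Q = emeasure lebesgue {a..b}"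
    by simp
  with Q(3) have "a < b"
    by (cases "a < b") (auto simp: emeasure_lborel_Icc_eq split: if_splits)
  with e have e: "emeasure lebesgue Q = ennreal (2 * ((b - a) / 2))"
    by simp
  have "Q \<subseteq> cball ((a + b) / 2) ((b - a) / 2)"
    using closure_subset[of Q] ab by (auto simp: cball_eq_atLeastAtMost field_simps)
  with \<open>a < b\<close> e Qm show ?thesis
    by (intro that[of "(b - a) / 2"]) auto
qed

lemma measurable_exp_abs[measurable]: "(\<lambda>x::real. ennreal (exp \<bar>x\<bar>)) \<in> borel_measurable lebesgue"
  by (intro measurable_completion) measurable

text \<open>Cut \<open>g\<close> at height \<open>s / 2\<close>: where an average of
  \<open>g\<close> exceeds \<open>s\<close>, the average of the upper part \<open>h\<close> is at
  least \<open>s / 2\<close>, and \<open>int\<close> forces that interval to be short. The weak type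
  estimate then applies to \<open>h\<close> at level \<open>s / 2\<close>, which doubles its
  constant.\<close>

lemma distr_fun_maximal_exp_abs:
  fixes g :: "real \<Rightarrow> ennreal"
  assumes g[measurable]: "g \<in> borel_measurable lebesgue"
    and A: "0 < A"
    and int: "(\<integral>\<^sup>+x. g x * indicator {x. ennreal A \<le> g x} x * ennreal (exp \<bar>x\<bar>) \<partial>lebesgue) \<le> ennreal A"
    and s: "2 * A \<le> s"
  shows "ennreal s * distr_fun (\<lambda>x. exp \<bar>x\<bar>) (maximal g) s
    \<le> ennreal (10 * exp 3) * (\<integral>\<^sup>+x. g x * indicator {x. ennreal (s / 2) \<le> g x} x * ennreal (exp \<bar>x\<bar>) \<partial>lebesgue)"
proof -
  define h where "h x = g x * indicator {x. ennreal (s / 2) \<le> g x} x" for x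
  have [measurable]: "{x. c \<le> g x} \<in> sets lebesgue" for c
    using measurable_sets[OF g, of "{c..}"] by (simp add: vimage_def)
  have h[measurable]: "h \<in> borel_measurable lebesgue"
    unfolding h_def by measurable
  have g_le: "g x \<le> h x + ennreal (s / 2)" for x
    by (auto simp: h_def split: split_indicator)
  \<comment> \<open>Here \<open>s / 2 \<ge> A\<close> and the fact that the weight is at least 1
    enter: unweighted integrals of \<open>h\<close> are bounded by the weighted integral in
    \<open>int\<close>.\<close>
  have h_le: "h x \<le> g x * indicator {x. ennreal A \<le> g x} x * ennreal (exp \<bar>x\<bar>)" for x
  proof (cases "ennreal (s / 2) \<le> g x")
    case True
    have "ennreal A \<le> ennreal (s / 2)"
      using s by (intro ennreal_leI) auto
    with True have "ennreal A \<le> g x"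
      by order
    moreover have "g x * 1 \<le> g x * ennreal (exp \<bar>x\<bar>)"
      by (intro mult_left_mono) auto
    ultimately show ?thesis using True by (simp add: h_def)
  qed (simp add: h_def)
  have "\<exists>a r. x \<in> cball a r \<and> 0 < r \<and> r \<le> 1/2 \<and>
      ennreal (s / 2 * (2 * r)) \<le> (\<integral>\<^sup>+y\<in>cball a r. h y \<partial>lebesgue)" if x: "ennreal s < maximal g x" for x
  proof -
    from x obtain Q where Q: "Q \<in> intervals" "x \<in> Q"
      "ennreal s < (\<integral>\<^sup>+y\<in>Q. g y \<partial>lebesgue) / emeasure lebesgue Q"
      unfolding maximal_def less_SUP_iff by auto
    from Q(1) obtain a r where r: "0 < r" "Q \<subseteq> cball a r" "emeasure lebesgue Q = ennreal (2 * r)"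
      and [measurable]: "Q \<in> sets lebesgue"
      by (rule intervals_cball)
    have "ennreal (s * (2 * r)) \<le> (\<integral>\<^sup>+y\<in>Q. g y \<partial>lebesgue)"
    proof (cases "\<integral>\<^sup>+y\<in>Q. g y \<partial>lebesgue" rule: ennreal_cases)
      case (real i)
      then have "s < i / (2 * r)"
        using Q(3) r A s by (simp add: divide_ennreal ennreal_less_iff)
      then show ?thesis
        using real r by (simp add: field_simps)
    qed auto
    also have "\<dots> \<le> (\<integral>\<^sup>+y. h y * indicator Q y + ennreal (s / 2) * indicator Q y \<partial>lebesgue)"
      using g_le by (intro nn_integral_mono) (auto split: split_indicator)
    also have "\<dots> = (\<integral>\<^sup>+y\<in>Q. h y \<partial>lebesgue) + (\<integral>\<^sup>+y. ennreal (s / 2) * indicator Q y \<partial>lebesgue)"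
      by (rule nn_integral_add) measurable
    also have "(\<integral>\<^sup>+y. ennreal (s / 2) * indicator Q y \<partial>lebesgue) = ennreal (s / 2) * ennreal (2 * r)"
      using r by (subst nn_integral_cmult_indicator) auto
    also have "\<dots> = ennreal (s / 2 * (2 * r))"
      using A s r by (subst ennreal_mult) auto
    \<comment> \<open>The contribution of the lower part is finite and is half of
      \<open>s * (2 * r)\<close>; subtracting it leaves the other half.\<close>
    finally have *: "ennreal (s / 2 * (2 * r)) \<le> (\<integral>\<^sup>+y\<in>Q. h y \<partial>lebesgue)"
      using r A s by (cases "\<integral>\<^sup>+y\<in>Q. h y \<partial>lebesgue" rule: ennreal_cases) (auto simp: mult.commute simp flip: ennreal_plus)
    have "(\<integral>\<^sup>+y\<in>Q. h y \<partial>lebesgue) \<le> ennreal A"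
      by (rule order_trans[OF nn_integral_mono int])
        (use h_le in \<open>auto split: split_indicator\<close>)
    with * have "ennreal (s / 2 * (2 * r)) \<le> ennreal A"
      by order
    \<comment> \<open>An interval of length \<open>2 * r > 1\<close> has average at most \<open>A\<close>, so it cannot see the level \<open>s\<close>.\<close>
    then have "s * r \<le> A"
      using A by simp
    moreover have "s * r > s * (1/2)" if "r > 1/2"
      using that A s by (intro mult_strict_left_mono) auto
    ultimately have "r \<le> 1/2"
      using s by force
    moreover have "(\<integral>\<^sup>+y\<in>Q. h y \<partial>lebesgue) \<le> (\<integral>\<^sup>+y\<in>cball a r. h y \<partial>lebesgue)"
      using r(2) by (intro nn_integral_mono) (auto split: split_indicator)
    ultimately show ?thesis
      using * r Q(2) by (intro exI[of _ a] exI[of _ r]) (auto intro: order_trans)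
  qed
  then have "ennreal (s / 2) * wmeas (\<lambda>x. exp \<bar>x\<bar>) {x. ennreal s < maximal g x}
      \<le> ennreal (5 * exp 3) * (\<integral>\<^sup>+y. h y * ennreal (exp \<bar>y\<bar>) \<partial>lebesgue)"
    using A s by (intro weak_type_exp_abs) auto
  then have "2 * (ennreal (s / 2) * distr_fun (\<lambda>x. exp \<bar>x\<bar>) (maximal g) s)
      \<le> 2 * (ennreal (5 * exp 3) * (\<integral>\<^sup>+y. h y * ennreal (exp \<bar>y\<bar>) \<partial>lebesgue))"
    unfolding distr_fun_def by (intro mult_left_mono) auto
  moreover have "2 * ennreal (s / 2) = ennreal s" "2 * ennreal (5 * exp 3) = ennreal (10 * exp 3)"
    using A s by (auto simp flip: ennreal_numeral ennreal_mult)
  ultimately show ?thesis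
    by (simp add: h_def flip: mult.assoc)
qed

section \<open>Rearrangements and distribution functions\<close>

lemma rearrangement_antimono: "s \<le> t \<Longrightarrow> rearrangement u g t \<le> rearrangement u g s"
  unfolding rearrangement_def
  by (intro INF_superset_mono) (auto intro: order_trans ennreal_leI)

text \<open>Superlevel sets of a monotone function are intervals, hence Borel.\<close>

lemma measurable_rearrangement[measurable]: "rearrangement u g \<in> borel_measurable lebesgue"
proof (rule borel_measurableI_greater)
  fix y
  have "is_interval {t. y < rearrangement u g t}"
    unfolding is_interval_1 using rearrangement_antimono[of _ _ u g] by (auto intro: less_le_trans)
  then have "{t. y < rearrangement u g t} \<in> sets borel"
    by (rule real_interval_borel_measurable)
  then show "{x \<in> space lebesgue. y < rearrangement u g x} \<in> sets lebesgue"
    by simp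
qed

text \<open>For \<open>s' < s\<close> the set where \<open>g\<close> exceeds \<open>s'\<close>
  contains the one where \<open>g\<close> is at least \<open>s\<close>, so no such \<open>s'\<close>
  is admissible in the infimum. Together with \<open>rearrangement_gtD\<close> this does the work of
  equimeasurability.\<close>

lemma rearrangement_ge:
  assumes "ennreal t < wmeas u {x. ennreal s \<le> g x}"
  shows "ennreal s \<le> rearrangement u g t"
  unfolding rearrangement_def
proof (rule INF_greatest)
  fix s' assume s': "s' \<in> {s. 0 < s \<and> distr_fun u g s \<le> ennreal t}"
  show "ennreal s \<le> ennreal s'"
  proof (rule ccontr)
    assume "\<not> ennreal s \<le> ennreal s'"
    then have "wmeas u {x. ennreal s \<le> g x} \<le> distr_fun u g s'"
      unfolding wmeas_def distr_fun_def
      by (intro nn_integral_mono) (auto split: split_indicator)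
    with s' assms show False by (auto simp: not_le[symmetric])
  qed
qed

lemma rearrangement_gtD:
  assumes "0 < s" "ennreal s < rearrangement u g t"
  shows "ennreal t < distr_fun u g s"
proof (rule ccontr)
  assume "\<not> ennreal t < distr_fun u g s"
  with assms(1) have "rearrangement u g t \<le> ennreal s"
    unfolding rearrangement_def by (intro INF_lower) auto
  with assms(2) show False by simp
qed

text \<open>Both sides are expanded by \<open>layer_cake\<close> and compared level by level. If the
  truncated level set has weight \<open>d\<close>, the rearrangement is at least \<open>s\<close> on
  \<open>(0,d)\<close>, and \<open>le1\<close> ensures that this lies in \<open>(0,1)\<close>, all
  that the norm sees.\<close>

lemma nn_integral_superlevel_le_rearrangement:
  fixes g :: "real \<Rightarrow> ennreal"
  assumes g[measurable]: "g \<in> borel_measurable lebesgue"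
    and u[measurable]: "(\<lambda>x. ennreal (u x)) \<in> borel_measurable lebesgue"
    and q: "0 < q"
    and le1: "wmeas u {x. ennreal A \<le> g x} \<le> 1"
  shows "(\<integral>\<^sup>+x. epowr (g x) q * (indicator {x. ennreal A \<le> g x} x * ennreal (u x)) \<partial>lebesgue)
    \<le> (\<integral>\<^sup>+t. epowr (rearrangement u g t) q * indicator {0<..<1} t \<partial>lebesgue)"
proof -
  have [measurable]: "{x. c \<le> g x} \<in> sets lebesgue" for c
    using measurable_sets[OF g, of "{c..}"] by (simp add: vimage_def)
  have le: "(\<integral>\<^sup>+x. indicator {x. ennreal A \<le> g x} x * ennreal (u x) * indicator {x. ennreal s \<le> g x} x \<partial>lebesgue)
      \<le> (\<integral>\<^sup>+t. indicator {0<..<1} t * indicator {t. ennreal s \<le> rearrangement u g t} t \<partial>lebesgue)"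
    (is "?L \<le> ?R") for s
  proof -
    have L1: "?L \<le> 1" and Ls: "?L \<le> wmeas u {x. ennreal s \<le> g x}"
      by (rule order_trans[OF _ le1]; unfold wmeas_def; intro nn_integral_mono; auto split: split_indicator)
        (unfold wmeas_def, intro nn_integral_mono, auto split: split_indicator)
    from L1 have "?L \<noteq> top" by (auto simp: top_unique)
    then obtain d where d: "0 \<le> d" "?L = ennreal d"
      by (cases ?L) auto
    have ge: "ennreal s \<le> rearrangement u g t" if "0 < t" "t < d" for t
    proof (rule rearrangement_ge)
      have "ennreal t < ?L"
        unfolding d(2) using that by (simp add: ennreal_less_iff)
      with Ls show "ennreal t < wmeas u {x. ennreal s \<le> g x}"
        by order
    qed
    have "?L = emeasure lebesgue {0<..<d}"
      using d by simp
    also have "\<dots> = (\<integral>\<^sup>+t. indicator {0<..<d} t \<partial>lebesgue)"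
      by (rule nn_integral_indicator[symmetric]) simp
    also have "\<dots> \<le> ?R"
      using ge L1 unfolding d(2) by (intro nn_integral_mono) (auto split: split_indicator)
    finally show ?thesis .
  qed
  have k: "(indicator {0<..<1} :: real \<Rightarrow> ennreal) \<in> borel_measurable lebesgue"
    by (rule borel_measurable_indicator) simp
  have kU: "(\<lambda>x. indicator {x. ennreal A \<le> g x} x * ennreal (u x)) \<in> borel_measurable lebesgue"
    by measurable
  show ?thesis
    unfolding layer_cake[OF sigma_finite_lebesgue measurable_rearrangement k q]
      layer_cake[OF sigma_finite_lebesgue g kU q]
    by (intro nn_integral_mono mult_left_mono le) auto
qed

text \<open>By \<open>rearrangement_gtD\<close>, the set lies in \<open>(0,d)\<close> with
  \<open>d\<close> the distribution function at \<open>s'\<close>. The gap between \<open>s'\<close>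
  and \<open>s\<close> turns the weak inequality of the level set into the strict one needed
  there.\<close>

lemma nn_integral_rearrangement_ge_le:
  fixes g :: "real \<Rightarrow> ennreal"
  assumes "0 < s'" "s' < s"
  shows "(\<integral>\<^sup>+t. indicator {0<..<1} t * indicator {t. ennreal s \<le> rearrangement u g t} t \<partial>lebesgue)
    \<le> distr_fun u g s'" (is "?L \<le> _")
proof (cases "distr_fun u g s'" rule: ennreal_cases)
  case (real d)
  have "t < d" if "ennreal s \<le> rearrangement u g t" "0 < t" for t
  proof -
    have "ennreal s' < ennreal s"
      using assms by (simp add: ennreal_less_iff)
    with that have "ennreal s' < rearrangement u g t"
      by order
    then have "ennreal t < ennreal d"
      using rearrangement_gtD[OF assms(1)] real by metis
    with that show ?thesis
      by (simp add: ennreal_less_iff)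
  qed
  then have "?L \<le> (\<integral>\<^sup>+t. indicator {0<..<d} t \<partial>lebesgue)"
    by (intro nn_integral_mono) (auto split: split_indicator)
  also have "\<dots> = emeasure lebesgue {0<..<d}"
    by (rule nn_integral_indicator) simp
  finally show ?thesis
    using real by simp
qed simp

section \<open>Marcinkiewicz truncation: from weak to strong type\<close>

text \<open>Reassembles the power \<open>q\<close> after \<open>layer_cake\<close> with exponent
  \<open>q - 1\<close> and a kernel containing \<open>g\<close>. At infinity both sides are
  infinite, as \<open>q - 1 > 0\<close>.\<close>

lemma epowr_cmult_mult_self:
  assumes "1 < q"
  shows "epowr (4 * y) (q - 1) * y = ennreal (4 powr (q - 1)) * epowr y q"
proof (cases y rule: ennreal_cases)
  case (real r)
  have "(4 * r) powr (q - 1) * r = 4 powr (q - 1) * r powr q"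
    using real by (cases "r = 0") (auto simp: powr_mult powr_diff)
  moreover have "4 * ennreal r = ennreal (4 * r)"
    using real by (simp add: ennreal_mult)
  ultimately show ?thesis
    using real by (simp add: epowr_ennreal flip: ennreal_mult)
qed (auto simp: epowr_def ennreal_mult_top ennreal_top_mult)

text \<open>The function \<open>y powr (1 - q)\<close> decreases because \<open>q > 1\<close>. Above
  height \<open>A\<close>, control of the power \<open>q\<close> therefore controls the first
  power.\<close>

lemma le_epowr:
  assumes "0 < A" "1 < q" "ennreal A \<le> y"
  shows "y \<le> ennreal (A powr (1 - q)) * epowr y q"
proof (cases y rule: ennreal_cases)
  case (real r)
  with assms have r: "0 < A" "A \<le> r" by auto
  have "r = r powr (1 - q) * r powr q"
    using r by (simp flip: powr_add)
  also have "\<dots> \<le> A powr (1 - q) * r powr q"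
    using r assms by (intro mult_right_mono powr_mono2') auto
  finally show ?thesis
    using real by (simp add: epowr_ennreal flip: ennreal_mult)
qed (use assms in \<open>auto simp: epowr_def ennreal_mult_top\<close>)

text \<open>The integral over levels is split at \<open>4 * A\<close>. Below, the length of
  \<open>(0,1)\<close> is the bound and yields \<open>(4 * A) powr q\<close>; above, the weak type
  bound is integrated and yields the term with \<open>q / (q - 1)\<close>.\<close>

lemma nn_integral_rearrangement_maximal_exp_abs:
  fixes g :: "real \<Rightarrow> ennreal" and q A :: real
  defines "u \<equiv> \<lambda>x::real. exp \<bar>x\<bar>"
  assumes g[measurable]: "g \<in> borel_measurable lebesgue"
    and A: "0 < A" and q: "1 < q"
    and le1: "wmeas u {x. ennreal A \<le> g x} \<le> 1"
    and int: "(\<integral>\<^sup>+t. epowr (rearrangement u g t) q * indicator {0<..<1} t \<partial>lebesgue) \<le> ennreal (A powr q)"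
  shows "(\<integral>\<^sup>+t. epowr (rearrangement u (maximal g) t) q * indicator {0<..<1} t \<partial>lebesgue)
    \<le> ennreal ((4 powr q + 20 * exp 3 * (q / (q - 1)) * 4 powr (q - 1)) * A powr q)"
proof -
  have [measurable]: "{x. c \<le> g x} \<in> sets lebesgue" for c
    using measurable_sets[OF g, of "{c..}"] by (simp add: vimage_def)
  have u[measurable]: "(\<lambda>x. ennreal (u x)) \<in> borel_measurable lebesgue"
    unfolding u_def by measurable
  define U where "U x = indicator {x. ennreal A \<le> g x} x * ennreal (u x)" for x
  have [measurable]: "U \<in> borel_measurable lebesgue"
    unfolding U_def by measurable
  have powq: "(\<integral>\<^sup>+x. epowr (g x) q * U x \<partial>lebesgue) \<le> ennreal (A powr q)"
    unfolding U_def using q by (intro order_trans[OF nn_integral_superlevel_le_rearrangement int] g u le1) auto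
  have mepow[measurable]: "(\<lambda>x. epowr (g x) q) \<in> borel_measurable lebesgue"
  proof -
    have "(\<lambda>x. if g x = \<infinity> then \<infinity> else ennreal (enn2real (g x) powr q)) \<in> borel_measurable lebesgue"
      by measurable
    then show ?thesis by (simp add: epowr_def)
  qed
  \<comment> \<open>The premise \<open>int\<close> of \<open>distr_fun_maximal_exp_abs\<close>,
    obtained from \<open>le_epowr\<close> on the set where \<open>g\<close> is at least
    \<open>A\<close>.\<close>
  have pow1: "(\<integral>\<^sup>+x. g x * indicator {x. ennreal A \<le> g x} x * ennreal (exp \<bar>x\<bar>) \<partial>lebesgue) \<le> ennreal A"
  proof -
    have "(\<integral>\<^sup>+x. g x * indicator {x. ennreal A \<le> g x} x * ennreal (exp \<bar>x\<bar>) \<partial>lebesgue)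
        \<le> (\<integral>\<^sup>+x. ennreal (A powr (1 - q)) * (epowr (g x) q * U x) \<partial>lebesgue)"
      using le_epowr[OF A q]
      by (intro nn_integral_mono) (auto simp: U_def u_def mult.assoc[symmetric] intro!: mult_right_mono split: split_indicator)
    also have "\<dots> = ennreal (A powr (1 - q)) * (\<integral>\<^sup>+x. epowr (g x) q * U x \<partial>lebesgue)"
      by (rule nn_integral_cmult) measurable
    also have "\<dots> \<le> ennreal (A powr (1 - q)) * ennreal (A powr q)"
      by (intro mult_left_mono powq) auto
    also have "\<dots> = ennreal A"
      using A by (simp flip: ennreal_mult powr_add)
    finally show ?thesis .
  qed
  define m where "m s = (\<integral>\<^sup>+t. indicator {0<..<1} t *
    indicator {t. ennreal s \<le> rearrangement u (maximal g) t} t \<partial>lebesgue)" for s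
  define G where "G s = (\<integral>\<^sup>+x. g x * U x * indicator {x. ennreal s \<le> 4 * g x} x \<partial>lebesgue)" for s
  have m1: "m s \<le> 1" for s
  proof -
    have "m s \<le> (\<integral>\<^sup>+t. indicator {0<..<1::real} t \<partial>lebesgue)"
      unfolding m_def by (intro nn_integral_mono) (auto split: split_indicator)
    also have "\<dots> = 1"
      by (subst nn_integral_indicator) auto
    finally show ?thesis .
  qed
  \<comment> \<open>The level is halved twice: once to get a strict inequality in
    \<open>nn_integral_rearrangement_ge_le\<close>, once by the truncation in
    \<open>distr_fun_maximal_exp_abs\<close>. Hence \<open>4 * A\<close>, the factor 4 in
    \<open>G\<close>, and 20 as twice 10.\<close>
  have mG: "ennreal s * m s \<le> ennreal (20 * exp 3) * G s" if s: "4 * A \<le> s" for s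
  proof -
    have "m s \<le> distr_fun u (maximal g) (s / 2)"
      unfolding m_def using A s by (intro nn_integral_rearrangement_ge_le) auto
    then have "ennreal (s / 2) * m s \<le> ennreal (s / 2) * distr_fun u (maximal g) (s / 2)"
      by (intro mult_left_mono) auto
    also have "\<dots> \<le> ennreal (10 * exp 3) *
        (\<integral>\<^sup>+x. g x * indicator {x. ennreal (s / 2 / 2) \<le> g x} x * ennreal (exp \<bar>x\<bar>) \<partial>lebesgue)"
      unfolding u_def using A s by (intro distr_fun_maximal_exp_abs[OF g A pow1]) auto
    also have "(\<integral>\<^sup>+x. g x * indicator {x. ennreal (s / 2 / 2) \<le> g x} x * ennreal (exp \<bar>x\<bar>) \<partial>lebesgue) = G s"
      unfolding G_def
    proof (rule nn_integral_cong)
      fix x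
      have "ennreal s \<le> 4 * g x \<longleftrightarrow> ennreal (s / 2 / 2) \<le> g x"
      proof (cases "g x" rule: ennreal_cases)
        case (real r)
        then have "4 * g x = ennreal (4 * r)"
          by (simp add: ennreal_mult)
        with real show ?thesis by (simp add: mult.commute)
      qed (simp add: ennreal_mult_top)
      moreover have "ennreal A \<le> ennreal (s / 2 / 2)"
        using s by (intro ennreal_leI) auto
      then have "ennreal (s / 2 / 2) \<le> g x \<Longrightarrow> ennreal A \<le> g x"
        by order
      ultimately show "g x * indicator {x. ennreal (s / 2 / 2) \<le> g x} x * ennreal (exp \<bar>x\<bar>) =
          g x * U x * indicator {x. ennreal s \<le> 4 * g x} x"
        by (auto simp: U_def u_def split: split_indicator)
    qed
    finally have "2 * (ennreal (s / 2) * m s) \<le> 2 * (ennreal (10 * exp 3) * G s)"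
      by (intro mult_left_mono) auto
    moreover have "2 * ennreal (s / 2) = ennreal s" "2 * ennreal (10 * exp 3) = ennreal (20 * exp 3)"
      using A s by (auto simp flip: ennreal_numeral ennreal_mult)
    ultimately show ?thesis
      by (simp flip: mult.assoc)
  qed
  \<comment> \<open>Chosen with \<open>c * (q - 1) = 20 * exp 3 * q\<close>, so that the high levels
    carry the density \<open>(q - 1) * s powr (q - 1 - 1)\<close> of \<open>layer_cake\<close> for
    exponent \<open>q - 1\<close>.\<close>
  define c where "c = 20 * exp 3 * (q / (q - 1))"
  have c: "0 \<le> c" using q by (simp add: c_def)
  define L where "L s = ennreal ((q - 1) * s powr (q - 1 - 1)) * indicator {0..} s * G s" for s :: real
  \<comment> \<open>\<open>G\<close> is a parameter integral of a jointly measurable function. Its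
    measurability allows the integral over levels to be split below.\<close>
  have Gm[measurable]: "G \<in> borel_measurable lborel"
  proof -
    interpret sigma_finite_measure "lebesgue :: real measure" by (rule sigma_finite_lebesgue)
    have [measurable]: "(\<lambda>p. g (snd p)) \<in> borel_measurable (lborel \<Otimes>\<^sub>M (lebesgue :: real measure))"
        "(\<lambda>p. U (snd p)) \<in> borel_measurable (lborel \<Otimes>\<^sub>M (lebesgue :: real measure))"
      by measurable
    have [measurable]: "{p \<in> space (lborel \<Otimes>\<^sub>M (lebesgue :: real measure)). ennreal (fst p) \<le> 4 * g (snd p)} \<in> sets (lborel \<Otimes>\<^sub>M (lebesgue :: real measure))"
      by measurable
    have "(\<lambda>p. g (snd p) * U (snd p) * indicator {p \<in> space (lborel \<Otimes>\<^sub>M (lebesgue :: real measure)). ennreal (fst p) \<le> 4 * g (snd p)} p)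
      \<in> borel_measurable (lborel \<Otimes>\<^sub>M (lebesgue :: real measure))" (is "?F \<in> _")
      by measurable
    then have "(\<lambda>s. \<integral>\<^sup>+x. ?F (s, x) \<partial>lebesgue) \<in> borel_measurable lborel"
      by (intro borel_measurable_nn_integral_fst)
    also have "(\<lambda>s. \<integral>\<^sup>+x. ?F (s, x) \<partial>lebesgue) = G"
      by (auto simp: G_def space_pair_measure intro!: ext nn_integral_cong split: split_indicator)
    finally show ?thesis .
  qed
  have k: "(indicator {0<..<1} :: real \<Rightarrow> ennreal) \<in> borel_measurable lebesgue"
    by (rule borel_measurable_indicator) simp
  have "0 < q" using q by simp
  have "(\<integral>\<^sup>+t. epowr (rearrangement u (maximal g) t) q * indicator {0<..<1} t \<partial>lebesgue) =
      (\<integral>\<^sup>+s. ennreal (q * s powr (q - 1)) * indicator {0..} s * m s \<partial>lborel)"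
    unfolding m_def by (rule layer_cake[OF sigma_finite_lebesgue measurable_rearrangement k \<open>0 < q\<close>])
  also have "\<dots> \<le> (\<integral>\<^sup>+s. ennreal (q * s powr (q - 1)) * indicator {s. 0 \<le> s \<and> ennreal s \<le> ennreal (4 * A)} s +
      ennreal c * L s \<partial>lborel)"
  proof (rule nn_integral_mono)
    fix s :: real
    consider "s < 0" | "0 \<le> s" "s \<le> 4 * A" | "4 * A < s"
      by linarith
    then show "ennreal (q * s powr (q - 1)) * indicator {0..} s * m s \<le>
      ennreal (q * s powr (q - 1)) * indicator {s. 0 \<le> s \<and> ennreal s \<le> ennreal (4 * A)} s + ennreal c * L s"
    proof cases
      case 2
      then have "ennreal (q * s powr (q - 1)) * m s \<le> ennreal (q * s powr (q - 1)) * 1"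
        by (intro mult_left_mono m1) auto
      also have "\<dots> \<le> ennreal (q * s powr (q - 1)) + ennreal c * L s"
        by simp
      finally show ?thesis
        using 2 A by (simp add: ennreal_leI)
    next
      case 3
      then have s: "0 < s" using A by linarith
      have "q * s powr (q - 1) = q * s powr (q - 1 - 1) * s"
        using s by (simp add: powr_diff power2_eq_square)
      then have "ennreal (q * s powr (q - 1)) * m s = ennreal (q * s powr (q - 1 - 1)) * (ennreal s * m s)"
        using q s by (simp add: ennreal_mult mult.assoc)
      also have "\<dots> \<le> ennreal (q * s powr (q - 1 - 1)) * (ennreal (20 * exp 3) * G s)"
        using 3 by (intro mult_left_mono mG) auto
      also have "\<dots> = ennreal (c * ((q - 1) * s powr (q - 1 - 1))) * G s"
      proof -
        have "c * ((q - 1) * s powr (q - 1 - 1)) = q * s powr (q - 1 - 1) * (20 * exp 3)"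
          using q by (simp add: c_def)
        also have "ennreal \<dots> = ennreal (q * s powr (q - 1 - 1)) * ennreal (20 * exp 3)"
          using q by (intro ennreal_mult) auto
        finally show ?thesis
          by (simp only: mult.assoc)
      qed
      also have "\<dots> = ennreal c * L s"
        using s q c by (simp add: L_def ennreal_mult mult.assoc)
      finally show ?thesis
        using s by (simp add: add_increasing)
    qed auto
  qed
  also have "\<dots> = (\<integral>\<^sup>+s. ennreal (q * s powr (q - 1)) * indicator {s. 0 \<le> s \<and> ennreal s \<le> ennreal (4 * A)} s \<partial>lborel) +
      (\<integral>\<^sup>+s. ennreal c * L s \<partial>lborel)"
    unfolding L_def by (rule nn_integral_add) measurable
  also have "(\<integral>\<^sup>+s. ennreal c * L s \<partial>lborel) = ennreal c * (\<integral>\<^sup>+s. L s \<partial>lborel)"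
    unfolding L_def by (rule nn_integral_cmult) measurable
  \<comment> \<open>\<open>layer_cake\<close> read backwards, with exponent \<open>q - 1\<close>,
    function \<open>4 * g\<close> and kernel \<open>g * U\<close>.\<close>
  also have "(\<integral>\<^sup>+s. L s \<partial>lborel) = (\<integral>\<^sup>+x. epowr (4 * g x) (q - 1) * (g x * U x) \<partial>lebesgue)"
    unfolding L_def G_def using q
    by (intro layer_cake[symmetric] sigma_finite_lebesgue) (auto, measurable)
  also have "\<dots> = (\<integral>\<^sup>+x. ennreal (4 powr (q - 1)) * (epowr (g x) q * U x) \<partial>lebesgue)"
    using epowr_cmult_mult_self[OF q] by (intro nn_integral_cong) (simp flip: mult.assoc)
  also have "\<dots> = ennreal (4 powr (q - 1)) * (\<integral>\<^sup>+x. epowr (g x) q * U x \<partial>lebesgue)"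
    by (rule nn_integral_cmult) measurable
  also have "(\<integral>\<^sup>+s. ennreal (q * s powr (q - 1)) * indicator {s. 0 \<le> s \<and> ennreal s \<le> ennreal (4 * A)} s \<partial>lborel)
      = ennreal (4 powr q * A powr q)"
    using q A by (subst epowr_eq_nn_integral[symmetric]) (auto simp: epowr_ennreal powr_mult simp del: ennreal_mult)
  also have "ennreal (4 powr q * A powr q) + ennreal c * (ennreal (4 powr (q - 1)) *
      (\<integral>\<^sup>+x. epowr (g x) q * U x \<partial>lebesgue)) \<le>
      ennreal (4 powr q * A powr q) + ennreal c * (ennreal (4 powr (q - 1)) * ennreal (A powr q))"
    by (intro add_left_mono mult_left_mono powq) auto
  also have "\<dots> = ennreal ((4 powr q + c * 4 powr (q - 1)) * A powr q)"
    using c by (simp add: algebra_simps flip: ennreal_mult ennreal_plus)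
  finally show ?thesis
    by (simp add: c_def)
qed

section \<open>Boundedness on the Lorentz space\<close>

lemma lorentz_norm_indicat:
  "lorentz_norm q u (indicat_real {0<..<1}) g =
    epowr (\<integral>\<^sup>+t. epowr (rearrangement u g t) q * indicator {0<..<1} t \<partial>lebesgue) (1 / q)"
  unfolding lorentz_norm_def
  by (rule arg_cong[where f = "\<lambda>x. epowr x (1 / q)"], rule nn_integral_cong)
    (auto split: split_indicator)

text \<open>A Chebyshev argument: were the weight larger than 1, the rearrangement would be at least
  \<open>A\<close> on all of \<open>(0,1)\<close>, and its integral at least
  \<open>A powr q > j\<close>.\<close>

lemma wmeas_superlevel_le_1:
  fixes g :: "real \<Rightarrow> ennreal"
  assumes q: "0 < q" and j: "0 \<le> j" "j powr (1 / q) < A"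
    and int: "(\<integral>\<^sup>+t. epowr (rearrangement u g t) q * indicator {0<..<1} t \<partial>lebesgue) \<le> ennreal j"
  shows "wmeas u {x. ennreal A \<le> g x} \<le> 1"
proof (rule ccontr)
  assume *: "\<not> wmeas u {x. ennreal A \<le> g x} \<le> 1"
  have A: "0 < A" using j by (meson le_less_trans powr_ge_zero)
  have "ennreal (A powr q) = (\<integral>\<^sup>+t. ennreal (A powr q) * indicator {0<..<1::real} t \<partial>lebesgue)"
    by (subst nn_integral_cmult_indicator) auto
  also have "\<dots> \<le> (\<integral>\<^sup>+t. epowr (rearrangement u g t) q * indicator {0<..<1} t \<partial>lebesgue)"
  proof (intro nn_integral_mono)
    fix t :: real
    have "epowr (ennreal A) q \<le> epowr (rearrangement u g t) q" if "0 < t" "t < 1"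
    proof (intro epowr_mono rearrangement_ge q)
      have "ennreal t < 1"
        using that by (simp add: ennreal_less_one_iff)
      with * show "ennreal t < wmeas u {x. ennreal A \<le> g x}"
        by order
    qed
    then show "ennreal (A powr q) * indicator {0<..<1} t \<le> epowr (rearrangement u g t) q * indicator {0<..<1} t"
      using A by (auto simp: epowr_ennreal split: split_indicator)
  qed
  also have "\<dots> \<le> ennreal j" by (rule int)
  finally have "A powr q \<le> j" using j by simp
  moreover have "(j powr (1 / q)) powr q < A powr q"
    using q j A by (intro powr_less_mono2) auto
  ultimately show False using q j by (simp add: powr_powr)
qed

lemma maximal_bounded_on_lorentz_exp_abs:
  assumes q: "1 < q"
  shows "maximal_bounded_on_lorentz q (\<lambda>x. exp \<bar>x\<bar>) (indicat_real {0<..<1})"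
proof -
  let ?u = "\<lambda>x::real. exp \<bar>x\<bar>"
  define C where "C = 4 powr q + 20 * exp 3 * (q / (q - 1)) * 4 powr (q - 1)"
  have C: "0 < C"
    using q by (auto simp: C_def intro!: add_pos_nonneg)
  show ?thesis
    unfolding maximal_bounded_on_lorentz_def lorentz_norm_indicat
  proof (intro exI[of _ "C powr (1 / q)"] allI impI)
    fix f :: "real \<Rightarrow> complex"
    assume f[measurable]: "f \<in> borel_measurable lebesgue"
    define g where "g x = ennreal (cmod (f x))" for x
    have g[measurable]: "g \<in> borel_measurable lebesgue"
      unfolding g_def by measurable
    let ?I = "\<lambda>g. \<integral>\<^sup>+t. epowr (rearrangement ?u g t) q * indicator {0<..<1} t \<partial>lebesgue"
    assume "epowr (?I (\<lambda>x. ennreal (cmod (f x)))) (1 / q) < \<infinity>"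
    then have "?I g \<noteq> \<infinity>"
      unfolding g_def epowr_def by (auto split: if_splits)
    then obtain j where j: "0 \<le> j" "?I g = ennreal j"
      by (cases "?I g" rule: ennreal_cases) auto
    \<comment> \<open>\<open>A\<close> is taken strictly above the norm
      \<open>j powr (1 / q)\<close>, as \<open>wmeas_superlevel_le_1\<close> demands. This keeps
      \<open>A\<close> positive even when the norm is 0; afterwards \<open>A\<close> decreases to
      the norm.\<close>
    have *: "epowr (?I (maximal g)) (1 / q) \<le> ennreal (C powr (1 / q) * A)" if A: "j powr (1 / q) < A" for A
    proof -
      have A0: "0 < A" using A by (meson le_less_trans powr_ge_zero)
      have "(j powr (1 / q)) powr q \<le> A powr q"
        using q A by (intro powr_mono2) auto
      then have "j \<le> A powr q"
        using q j by (simp add: powr_powr)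
      then have "?I (maximal g) \<le> ennreal (C * A powr q)"
        unfolding C_def using q A j A0
        by (intro nn_integral_rearrangement_maximal_exp_abs wmeas_superlevel_le_1[of q j]) auto
      then have "epowr (?I (maximal g)) (1 / q) \<le> epowr (ennreal (C * A powr q)) (1 / q)"
        using q by (intro epowr_mono) auto
      also have "\<dots> = ennreal (C powr (1 / q) * A)"
        using C q A0 by (simp add: epowr_ennreal powr_mult powr_powr)
      finally show ?thesis .
    qed
    \<comment> \<open>Take \<open>A\<close> to be the norm plus \<open>e / C powr (1 / q)\<close>,
      so that the error after multiplication by the constant is exactly \<open>e\<close>.\<close>
    have eps: "epowr (?I (maximal g)) (1 / q) \<le> ennreal (C powr (1 / q) * j powr (1 / q)) + ennreal e" if "0 < e" for e
    proof -
      have "C powr (1 / q) * (j powr (1 / q) + e / C powr (1 / q)) = C powr (1 / q) * j powr (1 / q) + e"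
        using C by (simp add: field_simps)
      then show ?thesis
        using * [of "j powr (1 / q) + e / C powr (1 / q)"] that C by (simp flip: ennreal_plus)
    qed
    have "epowr (?I (maximal g)) (1 / q) \<le> ennreal (C powr (1 / q) * j powr (1 / q))"
      by (rule ennreal_le_epsilon) (rule eps)
    also have "\<dots> = ennreal (C powr (1 / q)) * epowr (?I g) (1 / q)"
      using j by (simp add: epowr_ennreal ennreal_mult)
    finally show "epowr (?I (maximal (\<lambda>x. ennreal (cmod (f x))))) (1 / q)
        \<le> ennreal (C powr (1 / q)) * epowr (?I (\<lambda>x. ennreal (cmod (f x)))) (1 / q)"
      unfolding g_def .
  qed
qed

section \<open>Failure of the doubling condition\<close>

text \<open>\<open>{- (2 * R)..2 * R}\<close> has weight at most \<open>4 * R * exp (2 * R)\<close>,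
  while its double contains \<open>{3 * R..4 * R}\<close>, of weight at least
  \<open>R * exp (3 * R)\<close>. The ratio is at least \<open>exp R / 4\<close>, which is
  unbounded.\<close>

lemma not_doubling_exp_abs: "\<not> doubling (\<lambda>x. exp \<bar>x\<bar>)"
proof
  let ?u = "\<lambda>x::real. exp \<bar>x\<bar>"
  assume "doubling ?u"
  then obtain C where C: "\<And>Q. Q \<in> intervals \<Longrightarrow> wmeas ?u (double_interval Q) \<le> ennreal C * wmeas ?u Q"
    unfolding doubling_def by blast
  \<comment> \<open>Makes \<open>exp R\<close> exceed \<open>4 * \<bar>C\<bar>\<close>; the added 1
    keeps the logarithm positive when \<open>C = 0\<close>, and the modulus covers negative
    \<open>C\<close>.\<close>
  define R where "R = ln (4 * (\<bar>C\<bar> + 1))"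
  have R: "0 < R" "exp R = 4 * (\<bar>C\<bar> + 1)"
    by (auto simp: R_def ln_gt_zero)
  let ?Q = "{- (2 * R)..2 * R}"
  have Q: "?Q \<in> intervals"
    using R by (simp add: intervals_def is_interval_cc)
  have dQ: "{3 * R..4 * R} \<subseteq> double_interval ?Q"
  proof
    fix x assume "x \<in> {3 * R..4 * R}"
    then have "x = 2 * (x / 2)" "x / 2 \<in> ?Q"
      using R by auto
    then show "x \<in> double_interval ?Q"
      using R by (auto simp: double_interval_def)
  qed
  have "ennreal (R * exp (3 * R)) = (\<integral>\<^sup>+x. ennreal (exp (3 * R)) * indicator {3 * R..4 * R} x \<partial>lebesgue)"
    using R by (subst nn_integral_cmult_indicator) (auto simp: ennreal_mult mult.commute)
  also have "\<dots> \<le> wmeas ?u (double_interval ?Q)"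
    unfolding wmeas_def using dQ R
    by (intro nn_integral_mono) (auto split: split_indicator intro!: ennreal_leI)
  also have "\<dots> \<le> ennreal C * wmeas ?u ?Q"
    by (rule C[OF Q])
  also have "\<dots> \<le> ennreal \<bar>C\<bar> * (\<integral>\<^sup>+x. ennreal (exp (2 * R)) * indicator ?Q x \<partial>lebesgue)"
    unfolding wmeas_def
    by (rule mult_mono[OF _ nn_integral_mono]) (auto split: split_indicator intro!: ennreal_leI)
  also have "\<dots> = ennreal (\<bar>C\<bar> * (exp (2 * R) * (4 * R)))"
    using R by (subst nn_integral_cmult_indicator) (auto simp: ennreal_mult)
  finally have "R * exp (3 * R) \<le> \<bar>C\<bar> * (exp (2 * R) * (4 * R))"
    using R by (simp add: ennreal_le_iff)
  moreover have "exp (3 * R) = exp (2 * R) * exp R"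
    by (simp flip: exp_add)
  ultimately have "(R * exp (2 * R)) * exp R \<le> (R * exp (2 * R)) * (4 * \<bar>C\<bar>)"
    by (simp add: algebra_simps)
  then have "exp R \<le> 4 * \<bar>C\<bar>"
    using R by (subst (asm) mult_le_cancel_left_pos) auto
  with R show False by simp
qed

section \<open>Admissibility of the two weights as a counterexample\<close>

lemma weight_on_exp_abs: "weight_on UNIV (\<lambda>x. exp \<bar>x\<bar>)"
proof -
  have "set_integrable lebesgue {a..b} (\<lambda>x::real. exp \<bar>x\<bar>)" for a b
    by (intro absolutely_integrable_continuous_real continuous_intros)
  moreover have "\<not> (AE x in lebesgue. exp \<bar>x::real\<bar> = 0)"
    by (simp add: eventually_False ae_filter_eq_bot_iff)
  ultimately show ?thesis
    by (auto simp: weight_on_def)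
qed

lemma weight_on_indicat: "weight_on {0<..} (indicat_real {0<..<1})"
proof -
  have "set_integrable lebesgue ({0<..} \<inter> {a..b}) (indicat_real {0<..<1})" for a b :: real
  proof -
    have "emeasure lebesgue ({0<..<1} \<inter> {a..b}) \<le> emeasure lebesgue {0<..<1::real}"
      by (rule emeasure_mono) auto
    then have "emeasure lebesgue ({0<..<1} \<inter> {a..b}) < \<infinity>"
      by (rule order.strict_trans1) simp
    then have "integrable lebesgue (indicat_real ({0<..<1} \<inter> {a..b}))"
      by (rule integrable_real_indicator[rotated]) (rule sets.Int, simp_all)
    also have "indicat_real ({0<..<1} \<inter> {a..b}) =
        (\<lambda>x. indicat_real ({0<..} \<inter> {a..b}) x *\<^sub>R indicat_real {0<..<1} x)"
      by (auto split: split_indicator)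
    finally show ?thesis
      by (simp add: set_integrable_def)
  qed
  moreover have "\<not> (AE x::real in lebesgue. 0 < x \<longrightarrow> indicat_real {0<..<1} x = 0)"
  proof
    assume "AE x::real in lebesgue. 0 < x \<longrightarrow> indicat_real {0<..<1} x = 0"
    then have "AE x in lebesgue. x \<notin> {0<..<1::real}"
      by eventually_elim auto
    then have "emeasure lebesgue {0<..<1::real} = 0"
      by (subst (asm) AE_iff_measurable[of "{0<..<1}"]) auto
    then show False by simp
  qed
  ultimately show ?thesis
    by (auto simp: weight_on_def)
qed

theorem theorem3p3p10:
  fixes u w :: "real \<Rightarrow> real"
  assumes u: "u = (\<lambda>x. exp \<bar>x\<bar>)"
    and w: "w = indicat_real {0<..<1}"
  shows "(\<forall>q>1. maximal_bounded_on_lorentz q u w) \<and>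
         \<not> doubling u \<and>
         (\<forall>p>1. \<not> (\<forall>v \<omega>. weight_on UNIV v \<and> weight_on {0<..} \<omega> \<and>
                     maximal_bounded_on_lorentz p v \<omega> \<longrightarrow> doubling v))"
proof (intro conjI allI impI)
  show bounded: "maximal_bounded_on_lorentz q u w" if "1 < q" for q
    unfolding u w using that by (rule maximal_bounded_on_lorentz_exp_abs)
  show nd: "\<not> doubling u"
    unfolding u by (rule not_doubling_exp_abs)
  show "\<not> (\<forall>v \<omega>. weight_on UNIV v \<and> weight_on {0<..} \<omega> \<and>
      maximal_bounded_on_lorentz p v \<omega> \<longrightarrow> doubling v)" if "1 < p" for p
  proof
    assume "\<forall>v \<omega>. weight_on UNIV v \<and> weight_on {0<..} \<omega> \<and>
      maximal_bounded_on_lorentz p v \<omega> \<longrightarrow> doubling v"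
    moreover have "weight_on UNIV u" "weight_on {0<..} w"
      unfolding u w by (fact weight_on_exp_abs weight_on_indicat)+
    ultimately have "doubling u"
      using bounded[OF that] by blast
    with nd show False ..
  qed
qed

end
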